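(* Let $\Gamma=\mathrm{PSL}_2(\mathcal{O}_{-m})$ be a Bianchi group ($m$ a square-free positive integer). Then there is a $\Gamma$-equivariant homotopy equivalence between $\mathcal{H}_{\mathbb{C}}^3$ and $\mathcal{H}_{\mathbb{R}}^3$. In particular, $\mathcal{H}_{\mathbb{C}}^3/\Gamma$ is homotopy equivalent to $\mathcal{H}_{\mathbb{R}}^3/\Gamma$.
   Context: $\mathcal{O}_{-m}$ is the ring of integers of $\mathbb{Q}(\sqrt{-m})$. The group $\mathrm{PSL}_2(\mathbb{C})$ is the group of orientation preserving isometries of real hyperbolic 3-space $\mathcal{H}^3_{\mathbb{R}}$. In the Kleinian model $\mathcal{H}^3_{\mathbb{R}}=\{[y_0:y_1:y_2:y_3]\in \mathbb{P}(\mathbb{R}^4) \mid y_0^2-y_1^2-y_2^2-y_3^2>0\}$ this group is $\mathrm{PSO}(1,3)$, and the isometry between the upper half-space model and the Kleinian model yields an isomorphism $\mathrm{PSL}_2(\mathbb{C})\cong \mathrm{PSO}(1,3)$. Complex hyperbolic 3-space is $\mathcal{H}^3_{\mathbb{C}}=\{[z_0:z_1:z_2:z_3]\in \mathbb{P}(\mathbb{C}^4) \mid |z_0|^2-|z_1|^2-|z_2|^2-|z_3|^2>0\}$; via $\mathrm{PSO}(1,3)\hookrightarrow \mathrm{PSU}(1,3)$, the group $\Gamma$ acts on $\mathcal{H}^3_{\mathbb{C}}$ by biholomorphisms. *)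

theory Defs
  imports "HOL-Analysis.Analysis" "HOL-Algebra.Group_Action"
    "HOL-Computational_Algebra.Squarefree"
begin

section \<open>Quotient topologies and equivariant homotopy equivalences\<close>

text \<open>
  The points of the quotient are the values of the map: in what follows, lines in projective
  space and orbits of a group action.
\<close>

definition quotient_topology :: "'a topology \<Rightarrow> ('a \<Rightarrow> 'b) \<Rightarrow> 'b topology" where
  "quotient_topology X f =
     topology (\<lambda>U. U \<subseteq> f ` topspace X \<and> openin X {x \<in> topspace X. f x \<in> U})"

lemma istopology_quotient_topology:
  "istopology (\<lambda>U. U \<subseteq> f ` topspace X \<and> openin X {x \<in> topspace X. f x \<in> U})"
proof -
  have inter: "{x \<in> topspace X. f x \<in> S \<inter> T} =
      {x \<in> topspace X. f x \<in> S} \<inter> {x \<in> topspace X. f x \<in> T}" for S T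
    by blast
  have union: "{x \<in> topspace X. f x \<in> \<Union>\<K>} = (\<Union>U\<in>\<K>. {x \<in> topspace X. f x \<in> U})" for \<K>
    by blast
  show ?thesis
    unfolding istopology_def inter union by (auto simp: openin_Union)
qed

lemma openin_quotient_topology:
  "openin (quotient_topology X f) U \<longleftrightarrow>
     U \<subseteq> f ` topspace X \<and> openin X {x \<in> topspace X. f x \<in> U}"
  unfolding quotient_topology_def
  by (simp add: topology_inverse'[OF istopology_quotient_topology])

lemma topspace_quotient_topology [simp]: "topspace (quotient_topology X f) = f ` topspace X"
proof (rule antisym)
  have "{x \<in> topspace X. f x \<in> f ` topspace X} = topspace X"
    by blast
  then have "openin (quotient_topology X f) (f ` topspace X)"
    by (simp add: openin_quotient_topology)
  then show "f ` topspace X \<subseteq> topspace (quotient_topology X f)"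
    by (rule openin_subset)
  show "topspace (quotient_topology X f) \<subseteq> f ` topspace X"
    using openin_topspace[of "quotient_topology X f"] openin_quotient_topology[of X f] by blast
qed

lemma quotient_map_quotient_topology: "quotient_map X (quotient_topology X f) f"
  by (auto simp: quotient_map_def openin_quotient_topology)

definition orbit_space ::
    "('g, 'm) monoid_scheme \<Rightarrow> ('g \<Rightarrow> 'x \<Rightarrow> 'x) \<Rightarrow> 'x topology \<Rightarrow> 'x set topology" where
  "orbit_space G \<phi> X = quotient_topology X (orbit G \<phi>)"

definition equivariant_on ::
    "('g, 'm) monoid_scheme \<Rightarrow> ('g \<Rightarrow> 'x \<Rightarrow> 'x) \<Rightarrow> ('g \<Rightarrow> 'y \<Rightarrow> 'y) \<Rightarrow> 'x set \<Rightarrow> ('x \<Rightarrow> 'y) \<Rightarrow> bool"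
  where
  "equivariant_on G \<phi> \<psi> S f \<longleftrightarrow> (\<forall>g\<in>carrier G. \<forall>x\<in>S. f (\<phi> g x) = \<psi> g (f x))"

text \<open>
  The first argument of \<^const>\<open>homotopic_with\<close> is required of every stage of the
  homotopy, so the two homotopies below run through equivariant maps.
\<close>

definition equivariant_homotopy_equivalence ::
    "('g, 'm) monoid_scheme \<Rightarrow> ('g \<Rightarrow> 'x \<Rightarrow> 'x) \<Rightarrow> ('g \<Rightarrow> 'y \<Rightarrow> 'y) \<Rightarrow>
     'x topology \<Rightarrow> 'y topology \<Rightarrow> ('x \<Rightarrow> 'y) \<Rightarrow> bool" where
  "equivariant_homotopy_equivalence G \<phi> \<psi> X Y f \<longleftrightarrow>
     continuous_map X Y f \<and> equivariant_on G \<phi> \<psi> (topspace X) f \<and>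
     (\<exists>g. continuous_map Y X g \<and> equivariant_on G \<psi> \<phi> (topspace Y) g \<and>
          homotopic_with (equivariant_on G \<phi> \<phi> (topspace X)) X X (g \<circ> f) id \<and>
          homotopic_with (equivariant_on G \<psi> \<psi> (topspace Y)) Y Y (f \<circ> g) id)"


section \<open>Real and complex hyperbolic 3-space\<close>

text \<open>
  Homogeneous coordinates are indexed by the type \<^typ>\<open>4\<close>, whose elements are 0, 1, 2, 3
  (the numeral 4 denotes 0). The point \<open>[v]\<close> of projective space is the line spanned by \<open>v\<close>.
\<close>

definition proj_point :: "'a::field ^ 'n \<Rightarrow> ('a ^ 'n) set" where
  "proj_point v = vec.span {v}"

definition projective_space :: "('a::{field,topological_space} ^ 'n) set topology" where
  "projective_space = quotient_topology (top_of_set (- {0})) proj_point"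

definition real_hyperbolic_3space :: "(real ^ 4) set topology" where
  "real_hyperbolic_3space = subtopology projective_space
     {proj_point y | y. (y $ 0)\<^sup>2 - (y $ 1)\<^sup>2 - (y $ 2)\<^sup>2 - (y $ 3)\<^sup>2 > 0}"

definition complex_hyperbolic_3space :: "(complex ^ 4) set topology" where
  "complex_hyperbolic_3space = subtopology projective_space
     {proj_point z | z. (cmod (z $ 0))\<^sup>2 - (cmod (z $ 1))\<^sup>2 - (cmod (z $ 2))\<^sup>2 - (cmod (z $ 3))\<^sup>2 > 0}"


section \<open>The groups\<close>

definition SL2 :: "complex set \<Rightarrow> (complex ^ 2 ^ 2) monoid" where
  "SL2 R = \<lparr>carrier = {A. (\<forall>i j. A $ i $ j \<in> R) \<and> det A = 1}, mult = (**), one = mat 1\<rparr>"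

definition PSL2 :: "complex set \<Rightarrow> (complex ^ 2 ^ 2) set monoid" where
  "PSL2 R = SL2 R Mod {mat 1, - mat 1}"

definition form_matrix :: "'a::ring_1 ^ 4 ^ 4" where
  "form_matrix = (\<chi> i j. if i \<noteq> j then 0 else if i = 0 then 1 else - 1)"

definition SO13 :: "(real ^ 4 ^ 4) monoid" where
  "SO13 = \<lparr>carrier = {M. transpose M ** form_matrix ** M = form_matrix \<and> det M = 1},
           mult = (**), one = mat 1\<rparr>"

definition PSO13 :: "(real ^ 4 ^ 4) set monoid" where
  "PSO13 = SO13 Mod {mat 1, - mat 1}"

definition SU13 :: "(complex ^ 4 ^ 4) monoid" where
  "SU13 = \<lparr>carrier = {M. transpose (map_matrix cnj M) ** form_matrix ** M = form_matrix \<and> det M = 1},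
           mult = (**), one = mat 1\<rparr>"

definition SU13_center :: "(complex ^ 4 ^ 4) set" where
  "SU13_center = {mat c | c. c ^ 4 = 1}"

definition PSU13 :: "(complex ^ 4 ^ 4) set monoid" where
  "PSU13 = SU13 Mod SU13_center"

text \<open>A class of matrices modulo scalars acts on the lines of projective space.\<close>

definition proj_act :: "('a::field ^ 'n ^ 'n) set \<Rightarrow> ('a ^ 'n) set \<Rightarrow> ('a ^ 'n) set" where
  "proj_act C L = {M *v v | M v. M \<in> C \<and> v \<in> L}"

definition PSO13_into_PSU13 :: "(real ^ 4 ^ 4) set \<Rightarrow> (complex ^ 4 ^ 4) set" where
  "PSO13_into_PSU13 C = SU13_center <#>\<^bsub>SU13\<^esub> map_matrix complex_of_real ` C"


section \<open>From the upper half-space to the Kleinian model\<close>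

definition upper_half_space :: "(complex \<times> real) set" where
  "upper_half_space = {(z, t). t > 0}"

text \<open>
  The Poincare extension: with quaternionic notation \<open>q = z + t j\<close> this is
  \<open>q \<mapsto> (a q + b) (c q + d)\<^sup>-\<^sup>1\<close>.
\<close>

definition SL2_act :: "complex ^ 2 ^ 2 \<Rightarrow> complex \<times> real \<Rightarrow> complex \<times> real" where
  "SL2_act A = (\<lambda>(z, t).
     let a = A $ 1 $ 1; b = A $ 1 $ 2; c = A $ 2 $ 1; d = A $ 2 $ 2;
         D = (cmod (c * z + d))\<^sup>2 + (cmod c)\<^sup>2 * t\<^sup>2
     in (((a * z + b) * cnj (c * z + d) + a * cnj c * of_real (t\<^sup>2)) / of_real D, t / D))"

text \<open>
  Let \<open>Y\<close> be the vector below and \<open>\<langle>_, _\<rangle>\<close> the form of signature (1,3). Then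
  \<open>\<langle>Y(z,t), Y(z,t)\<rangle> = t\<^sup>2\<close> and \<open>\<langle>Y(z,t), Y(w,s)\<rangle> / (t s) = 1 + (\<bar>z - w\<bar>\<^sup>2 + (t - s)\<^sup>2) / (2 t s)\<close>,
  which is the hyperbolic cosine of the distance of \<open>(z,t)\<close> and \<open>(w,s)\<close> in both models.
\<close>

definition half_space_to_klein :: "complex \<times> real \<Rightarrow> (real ^ 4) set" where
  "half_space_to_klein = (\<lambda>(z, t). proj_point (\<chi> i.
     if i = 0 then ((cmod z)\<^sup>2 + t\<^sup>2 + 1) / 2
     else if i = 1 then Re z
     else if i = 2 then Im z
     else ((cmod z)\<^sup>2 + t\<^sup>2 - 1) / 2))"

text \<open>
  The isomorphism from \<open>PSL\<^sub>2(\<complex>)\<close> to \<open>PSO(1,3)\<close>: the matrices that act on the Kleinian model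
  as \<open>\<gamma>\<close> acts on the upper half-space. They form a coset in \<^const>\<open>PSO13\<close>, and the
  cosets of \<^const>\<open>PSO13_into_PSU13\<close> above lie in \<^const>\<open>PSU13\<close>.
\<close>

definition PSL2_to_PSO13 :: "(complex ^ 2 ^ 2) set \<Rightarrow> (real ^ 4 ^ 4) set" where
  "PSL2_to_PSO13 \<gamma> = {M \<in> carrier SO13. \<forall>A\<in>\<gamma>. \<forall>p\<in>upper_half_space.
     half_space_to_klein (SL2_act A p) = (*v) M ` half_space_to_klein p}"

definition real_action :: "(complex ^ 2 ^ 2) set \<Rightarrow> (real ^ 4) set \<Rightarrow> (real ^ 4) set" where
  "real_action \<gamma> = proj_act (PSL2_to_PSO13 \<gamma>)"

definition complex_action :: "(complex ^ 2 ^ 2) set \<Rightarrow> (complex ^ 4) set \<Rightarrow> (complex ^ 4) set" where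
  "complex_action \<gamma> = proj_act (PSO13_into_PSU13 (PSL2_to_PSO13 \<gamma>))"


section \<open>Bianchi groups\<close>

definition imag_quadratic_field :: "nat \<Rightarrow> complex set" where
  "imag_quadratic_field m = {of_rat a + of_rat b * csqrt (- of_nat m) | a b. True}"

definition imag_quadratic_integers :: "nat \<Rightarrow> complex set" where
  "imag_quadratic_integers m = {x \<in> imag_quadratic_field m. algebraic_int x}"

definition bianchi_group :: "nat \<Rightarrow> (complex ^ 2 ^ 2) set monoid" where
  "bianchi_group m = PSL2 (imag_quadratic_integers m)"

end

theory Submission
  imports Defs
begin

text \<open>
  For \<open>z \<in> \<complex>\<^sup>4\<close> let \<open>q(z) = z\<^sub>0\<^sup>2 - z\<^sub>1\<^sup>2 - z\<^sub>2\<^sup>2 - z\<^sub>3\<^sup>2\<close>. On the cone where the Hermitian form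
  is positive \<open>\<bar>q(z)\<bar>\<close> is at least the value of that form, so \<open>q(z) \<noteq> 0\<close> and the phase of \<open>z\<close>
  can be normalised, up to sign, such that \<open>q(z) > 0\<close>. Then \<open>z = x + i y\<close> with \<open>x\<close> timelike and
  \<open>y\<close> orthogonal to \<open>x\<close>, hence spacelike or zero, and \<open>[x + i t y]\<close> for \<open>0 \<le> t \<le> 1\<close> stays in complex
  hyperbolic space. This deformation retraction onto real hyperbolic space commutes with every real
  matrix that preserves the form.
\<close>

section \<open>Equivariant homotopy equivalences and orbit spaces\<close>

lemma image_orbit:
  assumes "equivariant_on G \<phi> \<psi> S f" "x \<in> S"
  shows "f ` orbit G \<phi> x = orbit G \<psi> (f x)"
  using assms by (simp add: orbit_def equivariant_on_def Setcompr_eq_image image_image)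

text \<open>By equivariance the direct image of an orbit is an orbit, so direct images serve as the
  induced map without a choice of representatives; continuity descends along the quotient map onto
  orbits.\<close>

lemma continuous_map_orbit_space_image:
  assumes f: "continuous_map X Y f" and eq: "equivariant_on G \<phi> \<psi> (topspace X) f"
  shows "continuous_map (orbit_space G \<phi> X) (orbit_space G \<psi> Y) ((`) f)"
proof -
  have "continuous_map X (orbit_space G \<psi> Y) ((`) f \<circ> orbit G \<phi>)"
    using continuous_map_compose[OF f quotient_imp_continuous_map[OF quotient_map_quotient_topology]]
    unfolding orbit_space_def by (rule continuous_map_eq) (simp add: image_orbit[OF eq])
  then show ?thesis
    unfolding orbit_space_def
    by (rule continuous_compose_quotient_map[OF quotient_map_quotient_topology])
qed

text \<open>Products with an identity map can destroy quotient maps; here local compactness and the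
  Hausdorff property of the interval prevent this. It is what lets homotopies descend to
  quotients.\<close>

lemma quotient_map_prod_unit_interval:
  assumes "quotient_map X Y f"
  shows "quotient_map (prod_topology (top_of_set {0..1::real}) X)
           (prod_topology (top_of_set {0..1}) Y) (\<lambda>(t, x). (t, f x))"
  by (rule quotient_map_prod_right)
    (auto simp: assms compact_imp_locally_compact_space compact_space_subtopology
       Hausdorff_space_subtopology)

lemma homotopic_orbit_space_image:
  assumes "homotopic_with (equivariant_on G \<phi> \<psi> (topspace X)) X Y p q"
  shows "homotopic_with (\<lambda>_. True) (orbit_space G \<phi> X) (orbit_space G \<psi> Y) ((`) p) ((`) q)"
proof -
  let ?I = "top_of_set {0..1::real}"
  obtain h where h: "continuous_map (prod_topology ?I X) Y h"
    and h0: "\<And>x. h (0, x) = p x" and h1: "\<And>x. h (1, x) = q x"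
    and eq: "\<And>t. t \<in> {0..1} \<Longrightarrow> equivariant_on G \<phi> \<psi> (topspace X) (\<lambda>x. h (t, x))"
    using assms unfolding homotopic_with_def by blast
  \<comment> \<open>The stage \<open>t\<close> of the homotopy acts on an orbit by direct image.
    Equivariance of each stage makes this the orbit of \<open>h (t, x)\<close>, so \<open>k\<close>
    is induced by \<open>h\<close>.\<close>
  define k where "k = (\<lambda>(t, S). (\<lambda>x. h (t, x)) ` S)"
  have orbit: "k (t, orbit G \<phi> x) = orbit G \<psi> (h (t, x))" if "t \<in> {0..1}" "x \<in> topspace X" for t x
    using image_orbit[OF eq[OF that(1)] that(2)] by (simp add: k_def)
  have "continuous_map (prod_topology ?I X) (orbit_space G \<psi> Y) (k \<circ> (\<lambda>(t, x). (t, orbit G \<phi> x)))"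
    using continuous_map_compose[OF h quotient_imp_continuous_map[OF quotient_map_quotient_topology]]
    unfolding orbit_space_def by (rule continuous_map_eq) (auto simp: orbit)
  then have "continuous_map (prod_topology ?I (orbit_space G \<phi> X)) (orbit_space G \<psi> Y) k"
    unfolding orbit_space_def
    by (rule continuous_compose_quotient_map
        [OF quotient_map_prod_unit_interval[OF quotient_map_quotient_topology]])
  then show ?thesis
    \<comment> \<open>The end conditions are demanded of every set, orbit or not; direct images
      under the end stages satisfy them since \<open>h0\<close> and \<open>h1\<close> hold for all
      points.\<close>
    unfolding homotopic_with_def by (intro exI[of _ k]) (simp add: k_def h0 h1)
qed

lemma equivariant_homotopy_equivalence_imp_orbit_space:
  assumes "equivariant_homotopy_equivalence G \<phi> \<psi> X Y f"
  shows "orbit_space G \<phi> X homotopy_equivalent_space orbit_space G \<psi> Y"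
proof -
  obtain g where g: "continuous_map X Y f" "equivariant_on G \<phi> \<psi> (topspace X) f"
    "continuous_map Y X g" "equivariant_on G \<psi> \<phi> (topspace Y) g"
    "homotopic_with (equivariant_on G \<phi> \<phi> (topspace X)) X X (g \<circ> f) id"
    "homotopic_with (equivariant_on G \<psi> \<psi> (topspace Y)) Y Y (f \<circ> g) id"
    using assms unfolding equivariant_homotopy_equivalence_def by blast
  \<comment> \<open>Functoriality of direct images turns the homotopies of the composites into
    homotopies on orbit spaces.\<close>
  have image: "(`) (g \<circ> f) = (`) g \<circ> (`) f" "(`) (f \<circ> g) = (`) f \<circ> (`) g"
    "(`) (id :: 'c \<Rightarrow> 'c) = id" "(`) (id :: 'd \<Rightarrow> 'd) = id"
    by (auto simp: fun_eq_iff)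
  show ?thesis
    unfolding homotopy_equivalent_space_def
    using continuous_map_orbit_space_image[OF g(1,2)] continuous_map_orbit_space_image[OF g(3,4)]
      homotopic_orbit_space_image[OF g(5)] homotopic_orbit_space_image[OF g(6)]
    unfolding image by blast
qed


section \<open>The timelike cones\<close>

definition real_timelike :: "(real ^ 4) set" where
  "real_timelike = {y. (y $ 0)\<^sup>2 - (y $ 1)\<^sup>2 - (y $ 2)\<^sup>2 - (y $ 3)\<^sup>2 > 0}"

definition complex_timelike :: "(complex ^ 4) set" where
  "complex_timelike = {z. (cmod (z $ 0))\<^sup>2 - (cmod (z $ 1))\<^sup>2 - (cmod (z $ 2))\<^sup>2 - (cmod (z $ 3))\<^sup>2 > 0}"

lemma proj_point_eq: "proj_point v = range (\<lambda>c. c *s v)"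
  by (simp add: proj_point_def vec.span_singleton)

lemma self_in_proj_point: "v \<in> proj_point v"
  by (simp add: proj_point_def vec.span_base)

lemma proj_point_scale: "c \<noteq> 0 \<Longrightarrow> proj_point (c *s v) = proj_point v"
  using vec.span_image_scale[of "{v}" "\<lambda>_. c"] by (simp add: proj_point_def)

text \<open>Stability under nonzero scalars makes \<open>P\<close> the full preimage of its set of
  lines (equation \<open>V\<close>), and a quotient map restricts to a quotient map over an open
  set.\<close>

lemma quotient_map_proj_point_cone:
  fixes P :: "('a::{field,topological_space} ^ 'n) set"
  assumes P: "open P" "0 \<notin> P" and scale: "\<And>c v. v \<in> P \<Longrightarrow> c \<noteq> 0 \<Longrightarrow> c *s v \<in> P"
  shows "quotient_map (top_of_set P) (subtopology projective_space {proj_point v | v. v \<in> P}) proj_point"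
proof -
  have V: "{v \<in> - {0}. proj_point v \<in> {proj_point v | v. v \<in> P}} = P"
  proof (intro equalityI subsetI)
    fix v assume "v \<in> {v \<in> - {0}. proj_point v \<in> {proj_point v | v. v \<in> P}}"
    then obtain w where "v \<noteq> 0" "w \<in> P" "proj_point v = proj_point w"
      by blast
    moreover from this obtain c where "v = c *s w"
      using self_in_proj_point[of v] by (auto simp: proj_point_eq)
    ultimately show "v \<in> P"
      using scale by (cases "c = 0") auto
  qed (use P in auto)
  have "openin projective_space {proj_point v | v. v \<in> P}"
    unfolding projective_space_def openin_quotient_topology topspace_euclidean_subtopology V
    using P by (auto simp: open_subset)
  then have "quotient_map (subtopology (top_of_set (- {0})) P)
      (subtopology projective_space {proj_point v | v. v \<in> P}) proj_point"
    using V by (intro quotient_map_restriction)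
      (auto simp: projective_space_def quotient_map_quotient_topology)
  moreover have "subtopology (top_of_set (- {0})) P = top_of_set P"
    using P by (simp add: subtopology_subtopology Int_absorb1 subset_Compl_singleton)
  ultimately show ?thesis
    by simp
qed

lemma quotient_map_real_timelike: "quotient_map (top_of_set real_timelike) real_hyperbolic_3space proj_point"
proof -
  have "quotient_map (top_of_set real_timelike)
      (subtopology projective_space {proj_point v | v. v \<in> real_timelike}) proj_point"
  proof (rule quotient_map_proj_point_cone)
    show "open real_timelike"
      unfolding real_timelike_def by (intro open_Collect_less continuous_intros)
    show "c *s v \<in> real_timelike" if "v \<in> real_timelike" "c \<noteq> 0" for c v
    proof -
      have "0 < c\<^sup>2 * ((v $ 0)\<^sup>2 - (v $ 1)\<^sup>2 - (v $ 2)\<^sup>2 - (v $ 3)\<^sup>2)"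
        using that by (simp add: real_timelike_def)
      then show ?thesis
        by (simp add: real_timelike_def power_mult_distrib algebra_simps)
    qed
  qed (simp add: real_timelike_def)
  then show ?thesis
    by (simp add: real_hyperbolic_3space_def real_timelike_def)
qed

lemma quotient_map_complex_timelike:
  "quotient_map (top_of_set complex_timelike) complex_hyperbolic_3space proj_point"
proof -
  have "quotient_map (top_of_set complex_timelike)
      (subtopology projective_space {proj_point v | v. v \<in> complex_timelike}) proj_point"
  proof (rule quotient_map_proj_point_cone)
    show "open complex_timelike"
      unfolding complex_timelike_def by (intro open_Collect_less continuous_intros)
    show "c *s v \<in> complex_timelike" if "v \<in> complex_timelike" "c \<noteq> 0" for c v
    proof -
      have "0 < (cmod c)\<^sup>2 *
          ((cmod (v $ 0))\<^sup>2 - (cmod (v $ 1))\<^sup>2 - (cmod (v $ 2))\<^sup>2 - (cmod (v $ 3))\<^sup>2)"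
        using that by (simp add: complex_timelike_def)
      then show ?thesis
        by (simp add: complex_timelike_def norm_mult power_mult_distrib algebra_simps)
    qed
  qed (simp add: complex_timelike_def)
  then show ?thesis
    by (simp add: complex_hyperbolic_3space_def complex_timelike_def)
qed

lemma topspace_real_hyperbolic_3space: "topspace real_hyperbolic_3space = proj_point ` real_timelike"
  using quotient_map_real_timelike by (auto simp: quotient_map_def)

lemma topspace_complex_hyperbolic_3space:
  "topspace complex_hyperbolic_3space = proj_point ` complex_timelike"
  using quotient_map_complex_timelike by (auto simp: quotient_map_def)


section \<open>Matrices preserving the form\<close>

text \<open>Bilinear also over the complex numbers: \<open>minkowski z z\<close> is the quadratic
  form q(z), not the Hermitian form that defines complex hyperbolic space.\<close>

definition minkowski :: "'a::comm_ring_1 ^ 4 \<Rightarrow> 'a ^ 4 \<Rightarrow> 'a" where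
  "minkowski v w = v $ 0 * w $ 0 - v $ 1 * w $ 1 - v $ 2 * w $ 2 - v $ 3 * w $ 3"

text \<open>\<open>sum_4\<close> runs over the indices 1 to 4, so coordinate 0 appears there under
  the name 4.\<close>

lemma four_eq_zero: "(4::4) = 0"
  by simp

text \<open>In this shape a matrix can be moved to the other argument as its transpose, which brings
  in the defining identity of \<open>SO13\<close>.\<close>

lemma minkowski_eq_sum: "minkowski v w = (\<Sum>i\<in>UNIV. v $ i * (form_matrix *v w) $ i)"
proof -
  have "(form_matrix *v w) $ i =
      (\<Sum>j\<in>UNIV. if i = j then if i = 0 then w $ j else - w $ j else 0)" for i
    unfolding matrix_vector_mult_def form_matrix_def vec_lambda_beta by (rule sum.cong) auto
  then show ?thesis
    by (simp add: minkowski_def sum_4 four_eq_zero)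
qed

lemma sum_matrix_vector_mult_left:
  fixes M :: "'a::comm_ring_1 ^ 'n ^ 'm"
  shows "(\<Sum>i\<in>UNIV. (M *v v) $ i * w $ i) = (\<Sum>i\<in>UNIV. v $ i * (transpose M *v w) $ i)"
  unfolding matrix_vector_mult_def transpose_def
  by (simp add: sum_distrib_left sum_distrib_right mult_ac) (rule sum.swap)

lemma minkowski_matrix:
  assumes "transpose M ** form_matrix ** M = form_matrix"
  shows "minkowski (M *v v) (M *v w) = minkowski v w"
  unfolding minkowski_eq_sum sum_matrix_vector_mult_left
  using assms by (simp add: matrix_vector_mul_assoc matrix_mul_assoc)

section \<open>Complexification of real vectors and matrices\<close>

abbreviation complexify_vec :: "real ^ 'n \<Rightarrow> complex ^ 'n" where
  "complexify_vec v \<equiv> \<chi> i. complex_of_real (v $ i)"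

abbreviation complexify :: "real ^ 'n ^ 'm \<Rightarrow> complex ^ 'n ^ 'm" where
  "complexify \<equiv> map_matrix complex_of_real"

lemma complexify_mult: "complexify (A ** B) = complexify A ** complexify B"
  by (simp add: vec_eq_iff matrix_matrix_mult_def)

lemma complexify_mult_vec: "complexify A *v complexify_vec v = complexify_vec (A *v v)"
  by (simp add: vec_eq_iff matrix_vector_mult_def)

lemma complexify_SO13:
  assumes "M \<in> carrier SO13"
  shows "transpose (complexify M) ** form_matrix ** complexify M = form_matrix"
proof -
  have "complexify (transpose M ** form_matrix ** M) = complexify form_matrix"
    using assms by (simp add: SO13_def)
  moreover have "complexify (transpose M) = transpose (complexify M)"
    "complexify form_matrix = form_matrix"
    by (simp_all add: vec_eq_iff transpose_def form_matrix_def)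
  ultimately show ?thesis
    by (simp add: complexify_mult)
qed

section \<open>The two actions as unions over real matrices\<close>

lemma PSL2_to_PSO13_subset: "PSL2_to_PSO13 \<gamma> \<subseteq> carrier SO13"
  by (auto simp: PSL2_to_PSO13_def)

lemma real_action_eq: "real_action \<gamma> L = (\<Union>M\<in>PSL2_to_PSO13 \<gamma>. (*v) M ` L)"
  by (auto simp: real_action_def proj_act_def)

text \<open>A class in \<open>PSU13\<close> differs from the real matrices only by fourth roots of
  unity. A set closed under scalars absorbs these, and the root 1 gives the converse
  inclusion.\<close>

lemma complex_action_eq:
  assumes L: "\<And>c v. v \<in> L \<Longrightarrow> c *s v \<in> L"
  shows "complex_action \<gamma> L = (\<Union>M\<in>PSL2_to_PSO13 \<gamma>. (*v) (complexify M) ` L)"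
proof -
  have scalar: "(mat c ** A) *v v = A *v (c *s v)" for c :: complex and A :: "complex ^ 4 ^ 4" and v
  proof -
    have "mat c *v w = c *s w" for w :: "complex ^ 4"
      by (simp add: vec_eq_iff matrix_vector_mult_def mat_def if_distribR if_distrib[of "\<lambda>x. x * _"]
          cong: if_cong)
    then show ?thesis
      by (simp add: matrix_vector_mul_assoc[symmetric] vector_scalar_commute)
  qed
  have "complex_action \<gamma> L =
      {(mat c ** complexify M) *v v | c M v. c ^ 4 = 1 \<and> M \<in> PSL2_to_PSO13 \<gamma> \<and> v \<in> L}"
    by (auto simp: complex_action_def proj_act_def PSO13_into_PSU13_def set_mult_def
        SU13_center_def SU13_def)
  also have "\<dots> = (\<Union>M\<in>PSL2_to_PSO13 \<gamma>. (*v) (complexify M) ` L)"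
    unfolding scalar using L by auto (metis power_one vector_smult_lid)
  finally show ?thesis .
qed

lemma image_matrix_proj_point: "(*v) M ` proj_point v = proj_point (M *v v)"
  by (auto simp: proj_point_eq image_image vector_scalar_commute)

lemma proj_point_closed: "v \<in> proj_point w \<Longrightarrow> c *s v \<in> proj_point w"
  by (simp add: proj_point_def vec.span_scale)


section \<open>The deformation retraction\<close>

lemma complexify_vec_in_timelike: "complexify_vec y \<in> complex_timelike \<longleftrightarrow> y \<in> real_timelike"
  by (simp add: complex_timelike_def real_timelike_def)

text \<open>Otherwise the square of \<open>z $ 0\<close> is the sum of the other three squares, and
  the triangle inequality makes the Hermitian form nonpositive.\<close>

lemma minkowski_nonzero:
  assumes "z \<in> complex_timelike"
  shows "minkowski z z \<noteq> 0"
proof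
  assume "minkowski z z = 0"
  then have "(z $ 0)\<^sup>2 = (z $ 1)\<^sup>2 + (z $ 2)\<^sup>2 + (z $ 3)\<^sup>2"
    by (simp add: minkowski_def power2_eq_square algebra_simps)
  then have "(cmod (z $ 0))\<^sup>2 = cmod ((z $ 1)\<^sup>2 + (z $ 2)\<^sup>2 + (z $ 3)\<^sup>2)"
    by (metis norm_power)
  also have "\<dots> \<le> (cmod (z $ 1))\<^sup>2 + (cmod (z $ 2))\<^sup>2 + (cmod (z $ 3))\<^sup>2"
    unfolding norm_power[symmetric] by (rule norm_triangle_le add_right_mono norm_triangle_ineq)+
  finally show False
    using assms by (simp add: complex_timelike_def)
qed

text \<open>
  If \<open>\<bar>u\<bar> = 1\<close> and \<open>u z = x + i y\<close> is normalised, that is \<open>u\<^sup>2 q(z) > 0\<close>, then this vector is a multiple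
  of \<open>x + i t y\<close>; the polynomial form avoids the choice of a square root.
\<close>

definition retract_vec :: "real \<Rightarrow> complex ^ 4 \<Rightarrow> complex ^ 4" where
  "retract_vec t z = (\<chi> i. of_real (1 + t) * cnj (minkowski z z) * z $ i
     + of_real ((1 - t) * cmod (minkowski z z)) * cnj (z $ i))"

text \<open>Both summands pick up the same factor: conj(c)^2 from q times c from z in the first,
  |c|^2 from |q| times conj(c) in the second. Hence the line of the result depends only on the line
  of z.\<close>

lemma retract_vec_scale:
  "retract_vec t (c *s z) = (of_real ((cmod c)\<^sup>2) * cnj c) *s retract_vec t z"
proof -
  have "minkowski (c *s z) (c *s z) = c\<^sup>2 * minkowski z z"
    by (simp add: minkowski_def power2_eq_square algebra_simps)
  moreover have "complex_of_real ((cmod c)\<^sup>2) = c * cnj c"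
    by (rule complex_norm_square)
  ultimately show ?thesis
    by (simp add: retract_vec_def vec_eq_iff norm_mult norm_power) (simp add: algebra_simps power2_eq_square)
qed

text \<open>A real matrix commutes with conjugation of coordinates, and membership in
  \<open>SO13\<close> leaves q(z) unchanged.\<close>

lemma retract_vec_complexify:
  assumes "M \<in> carrier SO13"
  shows "retract_vec t (complexify M *v z) = complexify M *v retract_vec t z"
proof -
  have "minkowski (complexify M *v z) (complexify M *v z) = minkowski z z"
    by (rule minkowski_matrix[OF complexify_SO13[OF assms]])
  then show ?thesis
    by (simp add: retract_vec_def vec_eq_iff matrix_vector_mult_def sum_distrib_left
        sum.distrib[symmetric] algebra_simps)
qed

lemma retract_vec_timelike:
  assumes z: "z \<in> complex_timelike" and t: "0 \<le> t" "t \<le> 1"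
  shows "retract_vec t z \<in> complex_timelike"
proof -
  define q where "q = minkowski z z"
  define a where "a = of_real (1 + t) * cnj q"
  define b where "b = (1 - t) * cmod q"
  define h where "h = (cmod (z $ 0))\<^sup>2 - (cmod (z $ 1))\<^sup>2 - (cmod (z $ 2))\<^sup>2 - (cmod (z $ 3))\<^sup>2"
  have "q \<noteq> 0"
    using minkowski_nonzero[OF z] by (simp add: q_def)
  have h: "h > 0"
    using z by (simp add: complex_timelike_def h_def)
  \<comment> \<open>The cross term contains x^2 rather than |x|^2, so the signed sum over the
    coordinates turns it into q.\<close>
  have norm: "(cmod (a * x + of_real b * cnj x))\<^sup>2 = ((cmod a)\<^sup>2 + b\<^sup>2) * (cmod x)\<^sup>2 + 2 * b * Re (a * (x * x))"
    for x
    unfolding cmod_power2 by (simp add: power2_eq_square algebra_simps)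
  have comp: "retract_vec t z $ i = a * z $ i + of_real b * cnj (z $ i)" for i
    by (simp add: retract_vec_def a_def b_def q_def)
  have "(cmod (retract_vec t z $ 0))\<^sup>2 - (cmod (retract_vec t z $ 1))\<^sup>2
      - (cmod (retract_vec t z $ 2))\<^sup>2 - (cmod (retract_vec t z $ 3))\<^sup>2
      = ((cmod a)\<^sup>2 + b\<^sup>2) * h + 2 * b * Re (a * q)"
    unfolding comp norm h_def q_def minkowski_def by (simp add: algebra_simps)
  \<comment> \<open>The factor conj(q) in \<open>a\<close> makes this cross term a nonnegative real;
    positivity then comes from the term with \<open>h\<close>.\<close>
  also have "a * q = of_real ((1 + t) * (cmod q)\<^sup>2)"
    unfolding a_def of_real_mult complex_norm_square by (simp add: mult_ac)
  finally have eq: "(cmod (retract_vec t z $ 0))\<^sup>2 - (cmod (retract_vec t z $ 1))\<^sup>2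
      - (cmod (retract_vec t z $ 2))\<^sup>2 - (cmod (retract_vec t z $ 3))\<^sup>2
      = ((cmod a)\<^sup>2 + b\<^sup>2) * h + 2 * b * ((1 + t) * (cmod q)\<^sup>2)"
    by simp
  have "of_real (1 + t) \<noteq> (0 :: complex)"
    using t by (simp only: of_real_eq_0_iff)
  then have "a \<noteq> 0"
    using \<open>q \<noteq> 0\<close> by (simp add: a_def)
  then have "((cmod a)\<^sup>2 + b\<^sup>2) * h > 0"
    using h by (simp add: add_pos_nonneg)
  moreover have "2 * b * ((1 + t) * (cmod q)\<^sup>2) \<ge> 0"
    using t by (simp add: b_def)
  ultimately show ?thesis
    unfolding complex_timelike_def mem_Collect_eq eq by linarith
qed

text \<open>A continuous choice of real representative: \<open>retract_vec 0 z\<close> is a complex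
  multiple of a real vector, and multiplying by the conjugate of its coordinate 0 removes the phase,
  so \<open>Re\<close> discards nothing.\<close>

definition real_vec :: "complex ^ 4 \<Rightarrow> real ^ 4" where
  "real_vec z = (\<chi> i. Re (cnj (retract_vec 0 z $ 0) * retract_vec 0 z $ i))"

lemma complexify_real_vec:
  "complexify_vec (real_vec z) = cnj (retract_vec 0 z $ 0) *s retract_vec 0 z"
proof -
  have "Im (cnj (retract_vec 0 z $ 0) * retract_vec 0 z $ i) = 0" for i
  proof -
    define q where "q = minkowski z z"
    \<comment> \<open>With |q|^2 = q conj(q) the product expands into two pairs of complex
      conjugates, those of |q|^2 conj(z_0) z_i and of |q| conj(q) z_0 z_i.\<close>
    have "cmod q * cmod q = Re q * Re q + Im q * Im q"
      using cmod_power2[of q] by (simp add: power2_eq_square)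
    then show ?thesis
      by (simp add: retract_vec_def q_def[symmetric]) algebra
  qed
  then show ?thesis
    by (simp add: real_vec_def vec_eq_iff complex_eq_iff)
qed

lemma complex_timelike_0_nonzero: "z \<in> complex_timelike \<Longrightarrow> z $ 0 \<noteq> 0"
  by (auto simp: complex_timelike_def) (smt (verit) zero_le_power2)

lemma proj_point_complexify_real_vec:
  assumes "z \<in> complex_timelike"
  shows "proj_point (complexify_vec (real_vec z)) = proj_point (retract_vec 0 z)"
  unfolding complexify_real_vec
  by (rule proj_point_scale) (simp add: complex_timelike_0_nonzero retract_vec_timelike assms)

lemma real_vec_timelike:
  assumes "z \<in> complex_timelike"
  shows "real_vec z \<in> real_timelike"
proof -
  have w: "retract_vec 0 z \<in> complex_timelike"
    using assms by (simp add: retract_vec_timelike)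
  let ?w = "retract_vec 0 z"
  have "0 < (cmod (?w $ 0))\<^sup>2 *
      ((cmod (?w $ 0))\<^sup>2 - (cmod (?w $ 1))\<^sup>2 - (cmod (?w $ 2))\<^sup>2 - (cmod (?w $ 3))\<^sup>2)"
    using w complex_timelike_0_nonzero[OF w] by (simp add: complex_timelike_def)
  then have "complexify_vec (real_vec z) \<in> complex_timelike"
    unfolding complexify_real_vec
    by (simp add: complex_timelike_def norm_mult power_mult_distrib algebra_simps)
  then show ?thesis
    by (simp only: complexify_vec_in_timelike)
qed

text \<open>Comparing real parts of coordinates replaces a complex scalar between two real vectors
  by its real part.\<close>

lemma complexify_vec_in_proj_point:
  "complexify_vec y \<in> proj_point (complexify_vec x) \<longleftrightarrow> y \<in> proj_point x"
proof
  assume "complexify_vec y \<in> proj_point (complexify_vec x)"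
  then obtain c where c: "complexify_vec y = c *s complexify_vec x"
    unfolding proj_point_eq by blast
  have "y $ i = Re c * x $ i" for i
    using arg_cong[OF c, of "\<lambda>v. Re (v $ i)"] by simp
  then have "y = Re c *s x"
    by (simp add: vec_eq_iff)
  then show "y \<in> proj_point x"
    by (auto simp: proj_point_eq)
next
  assume "y \<in> proj_point x"
  then obtain c where "y = c *s x"
    by (auto simp: proj_point_eq)
  then have "complexify_vec y = of_real c *s complexify_vec x"
    by (simp add: vec_eq_iff)
  then show "complexify_vec y \<in> proj_point (complexify_vec x)"
    by (auto simp: proj_point_eq)
qed

text \<open>
  The following maps are defined as unions because these commute with the actions on arbitrary sets
  of vectors. In particular they map \<open>{}\<close> to \<open>{}\<close>, so equivariance does not depend on the fact that
  every class of \<^const>\<open>PSL2_to_PSO13\<close> is inhabited.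
\<close>

definition retract_line :: "real \<Rightarrow> (complex ^ 4) set \<Rightarrow> (complex ^ 4) set" where
  "retract_line t L = (\<Union>z\<in>L. proj_point (retract_vec t z))"

definition to_real :: "(complex ^ 4) set \<Rightarrow> (real ^ 4) set" where
  "to_real L = {y. complexify_vec y \<in> retract_line 0 L}"

definition to_complex :: "(real ^ 4) set \<Rightarrow> (complex ^ 4) set" where
  "to_complex L = (\<Union>y\<in>L. proj_point (complexify_vec y))"

section \<open>The maps on lines and their composites\<close>

lemma retract_line_closed: "v \<in> retract_line t L \<Longrightarrow> c *s v \<in> retract_line t L"
  unfolding retract_line_def using proj_point_closed by blast

lemma to_complex_closed: "v \<in> to_complex L \<Longrightarrow> c *s v \<in> to_complex L"
  unfolding to_complex_def using proj_point_closed by blast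

text \<open>By homogeneity every vector of the line yields a vector of the same target line; the
  zero vector yields 0 and adds nothing.\<close>

lemma retract_line_proj_point: "retract_line t (proj_point z) = proj_point (retract_vec t z)"
proof
  show "retract_line t (proj_point z) \<subseteq> proj_point (retract_vec t z)"
    unfolding retract_line_def
    by (auto simp: proj_point_eq retract_vec_scale)
  show "proj_point (retract_vec t z) \<subseteq> retract_line t (proj_point z)"
    unfolding retract_line_def using self_in_proj_point by blast
qed

lemma to_complex_proj_point: "to_complex (proj_point y) = proj_point (complexify_vec y)"
proof
  have "proj_point (complexify_vec (c *s y)) \<subseteq> proj_point (complexify_vec y)" for c
  proof -
    have "complexify_vec (c *s y) = of_real c *s complexify_vec y"
      by (simp add: vec_eq_iff)
    then show ?thesis
      by (auto simp: proj_point_eq)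
  qed
  then show "to_complex (proj_point y) \<subseteq> proj_point (complexify_vec y)"
    unfolding to_complex_def proj_point_eq[of y] by blast
  show "proj_point (complexify_vec y) \<subseteq> to_complex (proj_point y)"
    unfolding to_complex_def using self_in_proj_point by blast
qed

lemma to_real_proj_point:
  assumes "z \<in> complex_timelike"
  shows "to_real (proj_point z) = proj_point (real_vec z)"
  unfolding to_real_def retract_line_proj_point proj_point_complexify_real_vec[OF assms, symmetric]
    complexify_vec_in_proj_point by simp

lemma to_complex_to_real:
  assumes "L \<in> topspace complex_hyperbolic_3space"
  shows "to_complex (to_real L) = retract_line 0 L"
  using assms
  by (auto simp: topspace_complex_hyperbolic_3space to_real_proj_point to_complex_proj_point
      proj_point_complexify_real_vec retract_line_proj_point)

lemma retract_line_1:
  assumes "L \<in> topspace complex_hyperbolic_3space"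
  shows "retract_line 1 L = L"
proof -
  obtain z where z: "z \<in> complex_timelike" "L = proj_point z"
    using assms by (auto simp: topspace_complex_hyperbolic_3space)
  \<comment> \<open>At \<open>t = 1\<close> the conjugate summand vanishes, and q(z) is
    nonzero.\<close>
  have "retract_vec 1 z = (2 * cnj (minkowski z z)) *s z"
    by (simp add: retract_vec_def vec_eq_iff)
  then show ?thesis
    by (simp only: z retract_line_proj_point) (simp add: proj_point_scale minkowski_nonzero z)
qed

lemma to_real_to_complex:
  assumes "L \<in> topspace real_hyperbolic_3space"
  shows "to_real (to_complex L) = L"
proof -
  obtain y where y: "y \<in> real_timelike" "L = proj_point y"
    using assms by (auto simp: topspace_real_hyperbolic_3space)
  define r where "r = minkowski y y"
  have r: "r > 0"
    using y(1) by (simp add: r_def minkowski_def real_timelike_def power2_eq_square)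
  have "minkowski (complexify_vec y) (complexify_vec y) = of_real r"
    by (simp add: r_def minkowski_def)
  \<comment> \<open>For a real timelike vector q is the positive real \<open>r\<close>, so both
    summands equal \<open>r\<close> times the vector.\<close>
  then have "retract_vec 0 (complexify_vec y) = of_real (2 * r) *s complexify_vec y"
    using r by (simp add: retract_vec_def vec_eq_iff)
  then have "proj_point (retract_vec 0 (complexify_vec y)) = proj_point (complexify_vec y)"
    using r by (simp only:) (rule proj_point_scale, simp)
  then show ?thesis
    unfolding y(2) to_complex_proj_point to_real_def retract_line_proj_point
    by (simp add: complexify_vec_in_proj_point)
qed

section \<open>Equivariance\<close>

lemma retract_line_image:
  assumes "M \<in> carrier SO13"
  shows "retract_line t ((*v) (complexify M) ` L) = (*v) (complexify M) ` retract_line t L"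
  by (simp add: retract_line_def image_UN retract_vec_complexify[OF assms] image_matrix_proj_point)

lemma to_complex_image: "to_complex ((*v) M ` L) = (*v) (complexify M) ` to_complex L"
  by (simp add: to_complex_def image_UN complexify_mult_vec image_matrix_proj_point)

text \<open>The inverse \<open>N\<close> of \<open>M\<close> is real too, so a preimage of the real
  vector \<open>y\<close> is the real vector \<open>N *v y\<close>. Thus passing to real points
  commutes with \<open>M\<close>.\<close>

lemma complexify_vec_in_image:
  assumes "invertible M"
  shows "complexify_vec y \<in> (*v) (complexify M) ` L \<longleftrightarrow> y \<in> (*v) M ` {x. complexify_vec x \<in> L}"
proof -
  obtain N where N: "N ** M = mat 1" "M ** N = mat 1"
    using assms by (auto simp: invertible_def)
  have cN: "complexify N ** complexify M = mat 1"
    unfolding complexify_mult[symmetric] N by (simp add: vec_eq_iff mat_def)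
  show ?thesis
  proof
    assume "complexify_vec y \<in> (*v) (complexify M) ` L"
    then obtain v where v: "v \<in> L" "complexify_vec y = complexify M *v v"
      by blast
    have "complexify_vec (N *v y) = v"
      unfolding complexify_mult_vec[symmetric] v(2) by (simp add: matrix_vector_mul_assoc cN)
    moreover have "y = M *v (N *v y)"
      by (simp add: matrix_vector_mul_assoc N)
    ultimately show "y \<in> (*v) M ` {x. complexify_vec x \<in> L}"
      using v(1) by blast
  next
    assume "y \<in> (*v) M ` {x. complexify_vec x \<in> L}"
    then show "complexify_vec y \<in> (*v) (complexify M) ` L"
      by (auto simp: complexify_mult_vec[symmetric])
  qed
qed

lemma to_real_image:
  assumes "M \<in> carrier SO13"
  shows "to_real ((*v) (complexify M) ` L) = (*v) M ` to_real L"
proof -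
  have "invertible M"
    using assms by (simp add: SO13_def invertible_det_nz)
  then show ?thesis
    by (auto simp: to_real_def retract_line_image[OF assms] complexify_vec_in_image)
qed

lemma complex_hyperbolic_3space_closed:
  "L \<in> topspace complex_hyperbolic_3space \<Longrightarrow> v \<in> L \<Longrightarrow> c *s v \<in> L"
  by (auto simp: topspace_complex_hyperbolic_3space proj_point_closed)

text \<open>Retraction and action are both unions, so they can be exchanged and the claim reduces to
  single matrices. Closure under scalars, before and after retracting, is what permits
  \<open>complex_action_eq\<close>.\<close>

lemma equivariant_retract_line:
  "equivariant_on G complex_action complex_action (topspace complex_hyperbolic_3space) (retract_line t)"
  unfolding equivariant_on_def
proof (intro ballI)
  fix \<gamma> L assume L: "L \<in> topspace complex_hyperbolic_3space"
  have "retract_line t (\<Union>M\<in>PSL2_to_PSO13 \<gamma>. (*v) (complexify M) ` L) =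
      (\<Union>M\<in>PSL2_to_PSO13 \<gamma>. retract_line t ((*v) (complexify M) ` L))"
    by (auto simp: retract_line_def)
  also have "\<dots> = (\<Union>M\<in>PSL2_to_PSO13 \<gamma>. (*v) (complexify M) ` retract_line t L)"
    using PSL2_to_PSO13_subset retract_line_image by (intro SUP_cong) blast+
  finally show "retract_line t (complex_action \<gamma> L) = complex_action \<gamma> (retract_line t L)"
    by (simp only: complex_action_eq complex_hyperbolic_3space_closed[OF L] retract_line_closed)
qed

lemma equivariant_to_real:
  "equivariant_on G complex_action real_action (topspace complex_hyperbolic_3space) to_real"
  unfolding equivariant_on_def
proof (intro ballI)
  fix \<gamma> L assume L: "L \<in> topspace complex_hyperbolic_3space"
  have "to_real (\<Union>M\<in>PSL2_to_PSO13 \<gamma>. (*v) (complexify M) ` L) =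
      (\<Union>M\<in>PSL2_to_PSO13 \<gamma>. to_real ((*v) (complexify M) ` L))"
    by (auto simp: to_real_def retract_line_def)
  also have "\<dots> = (\<Union>M\<in>PSL2_to_PSO13 \<gamma>. (*v) M ` to_real L)"
    using PSL2_to_PSO13_subset to_real_image by (intro SUP_cong) blast+
  finally show "to_real (complex_action \<gamma> L) = real_action \<gamma> (to_real L)"
    by (simp only: complex_action_eq complex_hyperbolic_3space_closed[OF L] real_action_eq)
qed

lemma equivariant_to_complex: "equivariant_on G real_action complex_action S to_complex"
  unfolding equivariant_on_def
proof (intro ballI)
  fix \<gamma> L
  have "to_complex (\<Union>M\<in>PSL2_to_PSO13 \<gamma>. (*v) M ` L) =
      (\<Union>M\<in>PSL2_to_PSO13 \<gamma>. to_complex ((*v) M ` L))"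
    by (auto simp: to_complex_def)
  then show "to_complex (real_action \<gamma> L) = complex_action \<gamma> (to_complex L)"
    by (simp only: complex_action_eq to_complex_closed real_action_eq to_complex_image)
qed

section \<open>Continuity, checked on the cones of vectors\<close>

lemma continuous_on_retract_vec:
  "continuous_on UNIV (\<lambda>(t, z). retract_vec t z)"
  unfolding retract_vec_def minkowski_def case_prod_beta
  by (intro continuous_on_vec_lambda continuous_intros)

text \<open>On vectors the map lifts to \<open>real_vec\<close>, whose continuity descends along the
  quotient map from the cone to lines.\<close>

lemma continuous_map_to_real:
  "continuous_map complex_hyperbolic_3space real_hyperbolic_3space to_real"
proof (rule continuous_compose_quotient_map[OF quotient_map_complex_timelike])
  have "continuous_on UNIV (retract_vec 0)"
    using continuous_on_compose2[OF continuous_on_retract_vec, of UNIV "\<lambda>z. (0, z)"]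
    by (simp add: continuous_intros)
  then have "continuous_on complex_timelike real_vec"
    unfolding real_vec_def
    by (intro continuous_on_vec_lambda continuous_intros) (auto intro: continuous_on_subset)
  then have "continuous_map (top_of_set complex_timelike) (top_of_set real_timelike) real_vec"
    by (auto simp: real_vec_timelike)
  from continuous_map_compose[OF this quotient_imp_continuous_map[OF quotient_map_real_timelike]]
  show "continuous_map (top_of_set complex_timelike) real_hyperbolic_3space (to_real \<circ> proj_point)"
    by (rule continuous_map_eq) (simp add: to_real_proj_point)
qed

lemma continuous_map_to_complex:
  "continuous_map real_hyperbolic_3space complex_hyperbolic_3space to_complex"
proof (rule continuous_compose_quotient_map[OF quotient_map_real_timelike])
  have "continuous_on real_timelike complexify_vec"
    by (intro continuous_on_vec_lambda continuous_intros)
  then have "continuous_map (top_of_set real_timelike) (top_of_set complex_timelike) complexify_vec"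
    by (auto simp: complexify_vec_in_timelike)
  from continuous_map_compose[OF this quotient_imp_continuous_map[OF quotient_map_complex_timelike]]
  show "continuous_map (top_of_set real_timelike) complex_hyperbolic_3space (to_complex \<circ> proj_point)"
    by (rule continuous_map_eq) (simp add: to_complex_proj_point)
qed

lemma continuous_map_retract_line:
  "continuous_map (prod_topology (top_of_set {0..1}) complex_hyperbolic_3space)
     complex_hyperbolic_3space (\<lambda>(t, L). retract_line t L)"
proof (rule continuous_compose_quotient_map
    [OF quotient_map_prod_unit_interval[OF quotient_map_complex_timelike]])
  have "continuous_map (prod_topology (top_of_set {0..1}) (top_of_set complex_timelike))
      (top_of_set complex_timelike) (\<lambda>(t, z). retract_vec t z)"
    using continuous_on_subset[OF continuous_on_retract_vec, of "{0..1} \<times> complex_timelike"]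
    by (auto simp: retract_vec_timelike)
  from continuous_map_compose[OF this quotient_imp_continuous_map[OF quotient_map_complex_timelike]]
  show "continuous_map (prod_topology (top_of_set {0..1}) (top_of_set complex_timelike))
      complex_hyperbolic_3space ((\<lambda>(t, L). retract_line t L) \<circ> (\<lambda>(t, z). (t, proj_point z)))"
    by (rule continuous_map_eq) (auto simp: retract_line_proj_point)
qed

text \<open>The inverse is \<open>to_complex\<close>. One composite is the identity on real
  hyperbolic space; the other is \<open>retract_line 0\<close>, joined to the identity by
  \<open>retract_line t\<close>.\<close>

lemma equivariant_homotopy_equivalence_to_real:
  "equivariant_homotopy_equivalence G complex_action real_action
     complex_hyperbolic_3space real_hyperbolic_3space to_real"
proof -
  let ?X = complex_hyperbolic_3space and ?Y = real_hyperbolic_3space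
  let ?P = "equivariant_on G complex_action complex_action (topspace ?X)"
  have maps: "to_real L \<in> topspace ?Y" if "L \<in> topspace ?X" for L
    using continuous_map_to_real that by (auto simp: continuous_map_def)
  have gf: "?P (to_complex \<circ> to_real)"
    using equivariant_to_real[of G] equivariant_to_complex[of G "topspace ?Y"] maps
    by (simp add: equivariant_on_def)
  have fg: "equivariant_on G real_action real_action (topspace ?Y) (to_real \<circ> to_complex)"
    using equivariant_to_real[of G] equivariant_to_complex[of G "topspace ?Y"]
      continuous_map_to_complex
    by (auto simp: equivariant_on_def continuous_map_def Pi_iff)
  have id: "equivariant_on G \<phi> \<phi> S id" for \<phi> S
    by (simp add: equivariant_on_def)
  \<comment> \<open>The two maps are known to agree on the points of the space, which suffices for a
    homotopy; the same applies to \<open>retract_line 1\<close> and \<open>id\<close>.\<close>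
  have "homotopic_with ?P ?X ?X (to_complex \<circ> to_real) (retract_line 0)"
    by (rule homotopic_with_equal)
      (use gf equivariant_retract_line to_complex_to_real
        continuous_map_compose[OF continuous_map_to_real continuous_map_to_complex] in auto)
  moreover have "homotopic_with ?P ?X ?X (retract_line 0) (retract_line 1)"
    unfolding homotopic_with_def
    using continuous_map_retract_line equivariant_retract_line
    by (intro exI[of _ "\<lambda>(t, L). retract_line t L"]) auto
  moreover have "homotopic_with ?P ?X ?X (retract_line 1) id"
    by (rule homotopic_with_symD, rule homotopic_with_equal)
      (use id equivariant_retract_line retract_line_1 in auto)
  ultimately have 1: "homotopic_with ?P ?X ?X (to_complex \<circ> to_real) id"
    by (blast intro: homotopic_with_trans)
  have 2: "homotopic_with (equivariant_on G real_action real_action (topspace ?Y)) ?Y ?Y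
      (to_real \<circ> to_complex) id"
    by (rule homotopic_with_equal)
      (use fg id to_real_to_complex
        continuous_map_compose[OF continuous_map_to_complex continuous_map_to_real] in auto)
  show ?thesis
    unfolding equivariant_homotopy_equivalence_def
    using continuous_map_to_real continuous_map_to_complex equivariant_to_real
      equivariant_to_complex 1 2 by blast
qed

theorem theorem17:
  fixes m :: nat
  assumes "m > 0" and "squarefree m"
  shows "(\<exists>f. equivariant_homotopy_equivalence (bianchi_group m) complex_action real_action
             complex_hyperbolic_3space real_hyperbolic_3space f) \<and>
         (orbit_space (bianchi_group m) complex_action complex_hyperbolic_3space)
           homotopy_equivalent_space
         (orbit_space (bianchi_group m) real_action real_hyperbolic_3space)"
  using equivariant_homotopy_equivalence_to_real equivariant_homotopy_equivalence_imp_orbit_space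
  by blast

end
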